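(* Let $\alpha>1$, let $n\in\mathbb{N}$ with $n>1$, and let $\eta:=\max\{1/\alpha,\,1-\alpha^{-1/(n-1)}\}$. If $f\in C^{m+1}([0,1])$ for some $m\in\mathbb{N}$, then $$\mathcal{E}^{\alpha}_{n,m}[f]\leq \frac{\sqrt{\pi}\,\eta^{m}}{2^{2m+1}(m+1)!\,\alpha}\,\|f^{(m+1)}\|_{\infty},$$ and $$\mathcal{N}\left(\mathcal{Q}^{\alpha}_{n,m}[f]\right)=(m+1)n.$$
   Context: $\mathbb{N}=\{1,2,\ldots\}$, $I=[0,1]$, $\hat I=[-1,1]$, and $\|\varphi\|_\infty$ denotes the maximum of $|\varphi|$ over its domain. Integrals: for $\alpha>0$, $\beta\in\mathbb{R}$ let $G_{\alpha,\beta}(x)=e^{-\alpha^2(x-\beta)^2}$ and $G_\alpha=G_{\alpha,0}$. For continuous $f$ on $[0,1]$, $\mathcal{I}_\alpha[f]=\int_0^1 f(x)G_\alpha(x)\,dx$; for continuous $g$ on $[-1,1]$, $\mathcal{I}_{\alpha,\beta}[g]=\int_{-1}^1 g(x)G_{\alpha,\beta}(x)\,dx$. Basic quadrature formula: for $m\in\mathbb{N}$ and $g\in C([-1,1])$, let $p_m$ be the Lagrange interpolation polynomial (of degree at most $m$) of $g$ at the $m+1$ Chebyshev points of the first kind $\cos\left((2i+1)\pi/(2m+2)\right)$, $i=0,1,\ldots,m$. Set $\mathcal{Q}^{\alpha,\beta}_m[g]:=\mathcal{I}_{\alpha,\beta}[p_m]$; it uses $m+1$ quadrature nodes. Graded mesh: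 for $\alpha>1$ and $n>1$ put $x_0=0$ and $x_j=\alpha^{(j-1)/(n-1)-1}$ for $j=1,\ldots,n$, and $h_j=x_j-x_{j-1}$. For $j=1,\ldots,n$ let $\alpha_j=\alpha h_j/2$, $\beta_j=-(x_{j-1}+x_j)/h_j$, and $f_j(x)=\frac{h_j}{2}f\left(\frac{h_j}{2}x+\frac{x_{j-1}+x_j}{2}\right)$ for $x\in[-1,1]$ (so that $\mathcal{I}_\alpha[f]=\sum_{j=1}^n\mathcal{I}_{\alpha_j,\beta_j}[f_j]$). Composite quadrature: $\mathcal{Q}^{\alpha}_{n,m}[f]:=\sum_{j=1}^n\mathcal{Q}^{\alpha_j,\beta_j}_m[f_j]$; its error is $\mathcal{E}^{\alpha}_{n,m}[f]:=\left|\mathcal{I}_\alpha[f]-\mathcal{Q}^{\alpha}_{n,m}[f]\right|$; and $\mathcal{N}(\mathcal{Q}^{\alpha}_{n,m}[f])$ is the total number of quadrature nodes used in $\mathcal{Q}^{\alpha}_{n,m}[f]$, i.e. the sum over $j=1,\ldots,n$ of the number of nodes used by the basic formula on the $j$-th subinterval. *)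

theory Defs
  imports "HOL-Analysis.Analysis" "HOL-Computational_Algebra.Polynomial"
begin

text \<open>The derivative is taken within \<open>S\<close>, hence one-sided at the endpoints of a closed interval.
  Values of \<open>f\<close> outside \<open>S\<close> are irrelevant for the values of \<open>nth_deriv_on S k f\<close> on \<open>S\<close>.\<close>

definition nth_deriv_on :: "real set \<Rightarrow> nat \<Rightarrow> (real \<Rightarrow> real) \<Rightarrow> real \<Rightarrow> real" where
  "nth_deriv_on S k f = ((\<lambda>g x. vector_derivative g (at x within S)) ^^ k) f"

definition C_k_on :: "nat \<Rightarrow> real set \<Rightarrow> (real \<Rightarrow> real) \<Rightarrow> bool" where
  "C_k_on k S f \<longleftrightarrow>
     (\<forall>j<k. nth_deriv_on S j f differentiable_on S) \<and> continuous_on S (nth_deriv_on S k f)"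

text \<open>For \<open>g\<close> continuous on a nonempty compact \<open>S\<close> the supremum is attained, so it is the maximum.\<close>

definition sup_norm_on :: "real set \<Rightarrow> (real \<Rightarrow> real) \<Rightarrow> real" where
  "sup_norm_on S g = (SUP x\<in>S. \<bar>g x\<bar>)"

definition gauss :: "real \<Rightarrow> real \<Rightarrow> real \<Rightarrow> real" where
  "gauss \<alpha> \<beta> x = exp (- (\<alpha>^2 * (x - \<beta>)^2))"

definition gauss_integral01 :: "real \<Rightarrow> (real \<Rightarrow> real) \<Rightarrow> real" where
  "gauss_integral01 \<alpha> f = integral {0..1} (\<lambda>x. f x * gauss \<alpha> 0 x)"

definition gauss_integral :: "real \<Rightarrow> real \<Rightarrow> (real \<Rightarrow> real) \<Rightarrow> real" where
  "gauss_integral \<alpha> \<beta> g = integral {-1..1} (\<lambda>x. g x * gauss \<alpha> \<beta> x)"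

definition chebyshev_points :: "nat \<Rightarrow> real set" where
  "chebyshev_points m = (\<lambda>i. cos ((2 * real i + 1) * pi / (2 * real m + 2))) ` {0..m}"

definition lagrange_poly :: "real set \<Rightarrow> (real \<Rightarrow> real) \<Rightarrow> real poly" where
  "lagrange_poly X g =
     (\<Sum>t\<in>X. smult (g t / (\<Prod>u\<in>X - {t}. t - u)) (\<Prod>u\<in>X - {t}. [:- u, 1:]))"

lemma degree_lagrange_poly:
  assumes "finite X"
  shows "degree (lagrange_poly X g) \<le> card X - 1"
  unfolding lagrange_poly_def
proof (rule degree_sum_le[OF assms])
  fix t assume t: "t \<in> X"
  have "degree (\<Prod>u\<in>X - {t}. [:- u, 1:]) \<le> (\<Sum>u\<in>X - {t}. degree [:- u, 1:])"
    using assms by (intro degree_prod_sum_le[of "X - {t}" "\<lambda>u. [:- u, 1:]", unfolded o_def]) simp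
  also have "\<dots> = card X - 1" using assms t by simp
  finally show "degree (smult (g t / (\<Prod>u\<in>X - {t}. t - u)) (\<Prod>u\<in>X - {t}. [:- u, 1:])) \<le> card X - 1"
    using degree_smult_le le_trans by blast
qed

lemma poly_lagrange_poly:
  assumes fin: "finite X" and s: "s \<in> X"
  shows "poly (lagrange_poly X g) s = g s"
proof -
  have "poly (lagrange_poly X g) s =
      (\<Sum>t\<in>X. g t / (\<Prod>u\<in>X - {t}. t - u) * (\<Prod>u\<in>X - {t}. s - u))"
    by (simp add: lagrange_poly_def poly_sum poly_prod)
  also have "\<dots> = (\<Sum>t\<in>X. if t = s then g s else 0)"
  proof (rule sum.cong[OF refl])
    fix t assume t: "t \<in> X"
    show "g t / (\<Prod>u\<in>X - {t}. t - u) * (\<Prod>u\<in>X - {t}. s - u) = (if t = s then g s else 0)"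
    proof (cases "t = s")
      case True
      have "(\<Prod>u\<in>X - {s}. s - u) \<noteq> 0" using fin by simp
      then show ?thesis using True by simp
    next
      case False
      then have "(\<Prod>u\<in>X - {t}. s - u) = 0" using fin s by (intro prod_zero) auto
      then show ?thesis using False by simp
    qed
  qed
  also have "\<dots> = g s" using fin s by simp
  finally show ?thesis .
qed

definition basic_quadrature :: "real \<Rightarrow> real \<Rightarrow> nat \<Rightarrow> (real \<Rightarrow> real) \<Rightarrow> real" where
  "basic_quadrature \<alpha> \<beta> m g = gauss_integral \<alpha> \<beta> (poly (lagrange_poly (chebyshev_points m) g))"

definition mesh_point :: "real \<Rightarrow> nat \<Rightarrow> nat \<Rightarrow> real" where
  "mesh_point \<alpha> n j = (if j = 0 then 0 else \<alpha> powr ((real j - 1) / (real n - 1) - 1))"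

definition mesh_width :: "real \<Rightarrow> nat \<Rightarrow> nat \<Rightarrow> real" where
  "mesh_width \<alpha> n j = mesh_point \<alpha> n j - mesh_point \<alpha> n (j - 1)"

definition local_alpha :: "real \<Rightarrow> nat \<Rightarrow> nat \<Rightarrow> real" where
  "local_alpha \<alpha> n j = \<alpha> * mesh_width \<alpha> n j / 2"

definition local_beta :: "real \<Rightarrow> nat \<Rightarrow> nat \<Rightarrow> real" where
  "local_beta \<alpha> n j = - (mesh_point \<alpha> n (j - 1) + mesh_point \<alpha> n j) / mesh_width \<alpha> n j"

definition local_map :: "real \<Rightarrow> nat \<Rightarrow> nat \<Rightarrow> real \<Rightarrow> real" where
  "local_map \<alpha> n j x =
     mesh_width \<alpha> n j / 2 * x + (mesh_point \<alpha> n (j - 1) + mesh_point \<alpha> n j) / 2"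

definition local_fun :: "real \<Rightarrow> nat \<Rightarrow> (real \<Rightarrow> real) \<Rightarrow> nat \<Rightarrow> real \<Rightarrow> real" where
  "local_fun \<alpha> n f j x = mesh_width \<alpha> n j / 2 * f (local_map \<alpha> n j x)"

definition composite_quadrature :: "real \<Rightarrow> nat \<Rightarrow> nat \<Rightarrow> (real \<Rightarrow> real) \<Rightarrow> real" where
  "composite_quadrature \<alpha> n m f =
     (\<Sum>j = 1..n. basic_quadrature (local_alpha \<alpha> n j) (local_beta \<alpha> n j) m (local_fun \<alpha> n f j))"

definition quadrature_error :: "real \<Rightarrow> nat \<Rightarrow> nat \<Rightarrow> (real \<Rightarrow> real) \<Rightarrow> real" where
  "quadrature_error \<alpha> n m f = \<bar>gauss_integral01 \<alpha> f - composite_quadrature \<alpha> n m f\<bar>"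

text \<open>The points of the \<open>j\<close>-th subinterval at which \<open>f\<close> is sampled: since
  \<open>local_fun \<alpha> n f j\<close> is sampled at the Chebyshev points, these are their images under the affine
  map from [-1,1] onto the subinterval. The node count depends on the formula only, not on \<open>f\<close>.\<close>

definition quadrature_nodes :: "real \<Rightarrow> nat \<Rightarrow> nat \<Rightarrow> nat \<Rightarrow> real set" where
  "quadrature_nodes \<alpha> n m j = local_map \<alpha> n j ` chebyshev_points m"

definition num_nodes :: "real \<Rightarrow> nat \<Rightarrow> nat \<Rightarrow> nat" where
  "num_nodes \<alpha> n m = (\<Sum>j = 1..n. card (quadrature_nodes \<alpha> n m j))"

end

theory Submission
  imports Defs
begin

text \<open>
  Writing \<open>h_j\<close> for the mesh widths, on the \<open>j\<close>-th subinterval the Lagrange remainder together with the extremal property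
  \<open>\<bar>\<Prod>u (x - u)\<bar> \<le> 2^-m\<close> of the Chebyshev nodes bounds the interpolation error of \<open>f\<close> by
  \<open>h_j^(m+1) / (2^(2m+1) (m+1)!)\<close> times the norm of the derivative. The grading of the mesh gives
  \<open>h_j \<le> \<eta> \<le> 1\<close>, so it remains to sum the weights of the subintervals. For this the sharp value of the
  Gaussian integral is not needed: \<open>exp (-y^2) \<le> 1 / (1 + y^2)\<close> gives the bound \<open>\<pi> / (2 \<alpha>)\<close>,
  and \<open>\<pi> / 2 \<le> sqrt \<pi>\<close>.
\<close>

section \<open>Rolle's theorem for several zeros and the Lagrange remainder\<close>

text \<open>Zeros are added in increasing order: each new largest zero \<open>c\<close> contributes,
  by the mean value theorem, a zero of \<open>f'\<close> between the previous maximum and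
  \<open>c\<close>. The clause \<open>y < Max Z\<close> makes that zero differ from all those found
  before.\<close>

lemma Rolle_finite_zeros:
  fixes f f' :: "real \<Rightarrow> real"
  assumes der: "\<And>x. x \<in> {a..b} \<Longrightarrow> (f has_real_derivative f' x) (at x within {a..b})"
    and "finite Z" "Z \<noteq> {}" "Z \<subseteq> {a..b}" "\<And>z. z \<in> Z \<Longrightarrow> f z = 0"
  shows "\<exists>Y. finite Y \<and> Suc (card Y) = card Z \<and> Y \<subseteq> {a..b} \<and> (\<forall>y\<in>Y. y < Max Z \<and> f' y = 0)"
  using assms(2-)
proof (induction Z rule: finite_linorder_max_induct)
  case empty
  then show ?case by simp
next
  case (insert c Z)
  have cnot: "c \<notin> Z" using insert.hyps by auto
  show ?case
  proof (cases "Z = {}")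
    case True
    then show ?thesis by (intro exI[of _ "{}"]) simp
  next
    case False
    with insert obtain Y where Y: "finite Y" "Suc (card Y) = card Z" "Y \<subseteq> {a..b}"
      "\<forall>y\<in>Y. y < Max Z \<and> f' y = 0"
      by auto
    have MZ: "Max Z \<in> Z" using insert.hyps False by auto
    then have less: "Max Z < c" and sub: "{Max Z..c} \<subseteq> {a..b}"
      using insert by auto
    have "\<exists>x\<in>{Max Z<..<c}. f c - f (Max Z) = (*) (f' x) (c - Max Z)"
    proof (rule mvt_simple[OF less])
      fix x assume "Max Z \<le> x" "x \<le> c"
      then have "(f has_real_derivative f' x) (at x within {Max Z..c})"
        using sub by (intro DERIV_subset[OF der]) auto
      then show "(f has_derivative (*) (f' x)) (at x within {Max Z..c})"
        by (simp add: has_field_derivative_def)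
    qed
    moreover have "f c = 0" "f (Max Z) = 0" using insert.prems MZ by auto
    ultimately obtain x where x: "x \<in> {Max Z<..<c}" "f' x = 0" using less by auto
    have "Max (insert c Z) = c" using insert.hyps less False by (simp add: max_absorb1)
    moreover have "x \<notin> Y" using Y x by auto
    moreover have "x \<in> {a..b}" using x sub by auto
    ultimately show ?thesis
      using Y x less cnot insert.hyps by (intro exI[of _ "insert x Y"]) auto
  qed
qed

text \<open>\<open>D i\<close> stands for the derivative of order \<open>i\<close>. Each pass of
  \<open>Rolle_finite_zeros\<close> costs one zero, and the induction continues with the shifted
  family.\<close>

lemma generalized_Rolle:
  fixes D :: "nat \<Rightarrow> real \<Rightarrow> real"
  assumes "\<And>i x. i < k \<Longrightarrow> x \<in> {a..b} \<Longrightarrow> (D i has_real_derivative D (Suc i) x) (at x within {a..b})"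
    and "finite Z" "card Z = Suc k" "Z \<subseteq> {a..b}" "\<And>z. z \<in> Z \<Longrightarrow> D 0 z = 0"
  shows "\<exists>\<xi>\<in>{a..b}. D k \<xi> = 0"
  using assms
proof (induction k arbitrary: D Z)
  case 0
  then obtain z where "z \<in> Z" by fastforce
  with 0 show ?case by auto
next
  case (Suc k)
  have "\<exists>Y. finite Y \<and> Suc (card Y) = card Z \<and> Y \<subseteq> {a..b} \<and> (\<forall>y\<in>Y. y < Max Z \<and> D (Suc 0) y = 0)"
    using Suc.prems by (intro Rolle_finite_zeros[of a b "D 0"]) auto
  then obtain Y where "finite Y" "card Y = Suc k" "Y \<subseteq> {a..b}" "\<And>y. y \<in> Y \<Longrightarrow> D (Suc 0) y = 0"
    using Suc.prems(3) by auto
  then show ?case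
    using Suc.prems(1) by (intro Suc.IH[of "\<lambda>i. D (Suc i)" Y]) auto
qed

text \<open>Differentiating \<open>n\<close> times kills all coefficients below index
  \<open>n\<close>, and the degree bound excludes higher ones. This extracts the constant
  \<open>K\<close> in the remainder formula.\<close>

lemma poly_higher_pderiv_degree_le:
  fixes p :: "'a :: {comm_semiring_1, semiring_no_zero_divisors, semiring_char_0} poly"
  assumes "degree p \<le> n"
  shows "poly ((pderiv ^^ n) p) x = fact n * coeff p n"
proof -
  have "(pderiv ^^ n) p = [:fact n * coeff p n:]"
  proof (rule poly_eqI)
    fix k
    show "coeff ((pderiv ^^ n) p) k = coeff [:fact n * coeff p n:] k"
      using assms by (cases k) (simp_all add: coeff_higher_pderiv pochhammer_fact coeff_eq_0)
  qed
  then show ?thesis by simp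
qed

lemma monic_prod_linear:
  fixes X :: "'a :: idom set"
  shows "degree (\<Prod>u\<in>X. [:- u, 1:]) = card X" "coeff (\<Prod>u\<in>X. [:- u, 1:]) (card X) = 1"
proof -
  show *: "degree (\<Prod>u\<in>X. [:- u, 1:]) = card X"
    using degree_prod_eq_sum_degree[of X "\<lambda>u. [:- u, 1:]"] by simp
  have "lead_coeff (\<Prod>u\<in>X. [:- u, 1:]) = 1"
    by (simp add: lead_coeff_prod)
  then show "coeff (\<Prod>u\<in>X. [:- u, 1:]) (card X) = 1" using * by simp
qed

text \<open>At a node both sides vanish. Elsewhere the interpolant is corrected by a multiple of the
  node polynomial so that it also matches \<open>D 0\<close> at \<open>x\<close>; the difference
  then has \<open>card X + 1\<close> zeros, so its derivative of order \<open>card X\<close>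
  vanishes somewhere.\<close>

lemma lagrange_remainder:
  fixes D :: "nat \<Rightarrow> real \<Rightarrow> real"
  assumes der: "\<And>i x. i < card X \<Longrightarrow> x \<in> {a..b} \<Longrightarrow>
        (D i has_real_derivative D (Suc i) x) (at x within {a..b})"
    and X: "finite X" "X \<noteq> {}" "X \<subseteq> {a..b}" and x: "x \<in> {a..b}"
  shows "\<exists>\<xi>\<in>{a..b}. D 0 x - poly (lagrange_poly X (D 0)) x
           = D (card X) \<xi> / fact (card X) * (\<Prod>u\<in>X. x - u)"
proof (cases "x \<in> X")
  case True
  then have "(\<Prod>u\<in>X. x - u) = 0" using X by (intro prod_zero) auto
  then show ?thesis using True X x by (auto simp: poly_lagrange_poly)
next
  case False
  define W where "W = (\<Prod>u\<in>X. [:- u, 1:])"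
  define P where "P = lagrange_poly X (D 0)"
  have W: "poly W y = (\<Prod>u\<in>X. y - u)" for y by (simp add: W_def poly_prod)
  have Wx: "poly W x \<noteq> 0" using False X by (auto simp: W)
  \<comment> \<open>Chosen so that \<open>Q\<close> agrees with \<open>D 0\<close> at
    \<open>x\<close>; agreement at the nodes survives because \<open>W\<close> vanishes
    there.\<close>
  define K where "K = (D 0 x - poly P x) / poly W x"
  define Q where "Q = P + smult K W"
  have "degree P < card X"
    using degree_lagrange_poly[of X "D 0"] X unfolding P_def
    by (metis Suc_pred' card_gt_0_iff le_imp_less_Suc)
  then have Q: "degree Q \<le> card X" "coeff Q (card X) = K"
    using monic_prod_linear[of X]
    by (auto simp: Q_def W_def coeff_eq_0 intro!: degree_add_le order.trans[OF degree_smult_le])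
  have "\<exists>\<xi>\<in>{a..b}. D (card X) \<xi> - poly ((pderiv ^^ card X) Q) \<xi> = 0"
  proof (rule generalized_Rolle[where Z = "insert x X"])
    show "card (insert x X) = Suc (card X)" using False X by simp
    fix z assume "z \<in> insert x X"
    then show "D 0 z - poly ((pderiv ^^ 0) Q) z = 0"
    proof
      assume "z = x"
      then show ?thesis using Wx by (simp add: Q_def K_def)
    next
      assume "z \<in> X"
      moreover from this have "poly W z = 0" using X by (auto simp: W)
      ultimately show ?thesis using X by (simp add: Q_def P_def poly_lagrange_poly)
    qed
  qed (use X x in \<open>auto intro!: DERIV_diff der DERIV_subset[OF poly_DERIV]\<close>)
  then obtain \<xi> where "\<xi> \<in> {a..b}" "D (card X) \<xi> = fact (card X) * K"
    using Q by (auto simp: poly_higher_pderiv_degree_le)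
  then show ?thesis
    using Wx by (intro bexI[of _ \<xi>]) (simp_all add: K_def P_def W)
qed

section \<open>Chebyshev polynomials of the first kind and their zeros\<close>

fun chebyshev_poly :: "nat \<Rightarrow> real poly" where
  "chebyshev_poly 0 = 1"
| "chebyshev_poly (Suc 0) = [:0, 1:]"
| "chebyshev_poly (Suc (Suc n)) = [:0, 2:] * chebyshev_poly (Suc n) - chebyshev_poly n"

lemma poly_chebyshev_poly_cos: "poly (chebyshev_poly n) (cos t) = cos (real n * t)"
proof (induction n rule: chebyshev_poly.induct)
  case (3 n)
  \<comment> \<open>Both angles are centred at \<open>real (Suc n) * t\<close>, so that the addition
    formulas sum to the three-term recurrence.\<close>
  have "cos (real (Suc (Suc n)) * t) = cos (real (Suc n) * t + t)"
       "cos (real n * t) = cos (real (Suc n) * t - t)"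
    by (simp_all add: algebra_simps)
  with 3 show ?case by (simp add: cos_add cos_diff del: of_nat_Suc)
qed simp_all

lemma degree_chebyshev_poly: "degree (chebyshev_poly n) \<le> n"
proof (induction n rule: chebyshev_poly.induct)
  case (3 n)
  have "degree ([:0, 2:] * chebyshev_poly (Suc n)) \<le> 1 + Suc n"
    using 3 by (intro order.trans[OF degree_mult_le] add_mono) simp_all
  with 3 show ?case by (auto intro!: degree_diff_le)
qed simp_all

text \<open>Each step of the recurrence doubles the leading coefficient, since the subtracted
  polynomial has too small a degree to interfere.\<close>

lemma coeff_chebyshev_poly: "coeff (chebyshev_poly (Suc n)) (Suc n) = 2 ^ n"
proof (induction n)
  case (Suc n)
  have "coeff (chebyshev_poly n) (Suc (Suc n)) = 0"
    using degree_chebyshev_poly[of n] by (intro coeff_eq_0) linarith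
  with Suc show ?case by simp
qed simp

text \<open>All angles lie in \<open>[0, pi]\<close>, where the cosine is injective. Both the root
  count in the factorization and the final node count rest on the nodes being distinct.\<close>

lemma inj_on_chebyshev_angles:
  "inj_on (\<lambda>i. cos ((2 * real i + 1) * pi / (2 * real m + 2))) {0..m}"
proof (rule inj_onI)
  fix i j assume ij: "i \<in> {0..m}" "j \<in> {0..m}"
    and eq: "cos ((2 * real i + 1) * pi / (2 * real m + 2)) = cos ((2 * real j + 1) * pi / (2 * real m + 2))"
  have "0 \<le> (2 * real k + 1) * pi / (2 * real m + 2) \<and> (2 * real k + 1) * pi / (2 * real m + 2) \<le> pi"
    if "k \<in> {0..m}" for k
    using that by (auto simp: divide_le_eq)
  then have "(2 * real i + 1) * pi / (2 * real m + 2) = (2 * real j + 1) * pi / (2 * real m + 2)"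
    using ij eq cos_inj_pi by blast
  then show "i = j" by (simp add: divide_eq_eq)
qed

lemma finite_chebyshev_points [simp]: "finite (chebyshev_points m)"
  by (simp add: chebyshev_points_def)

lemma card_chebyshev_points: "card (chebyshev_points m) = m + 1"
  unfolding chebyshev_points_def by (simp add: card_image[OF inj_on_chebyshev_angles])

lemma chebyshev_points_subset: "chebyshev_points m \<subseteq> {-1..1}"
  by (auto simp: chebyshev_points_def)

text \<open>Multiplying the angle of a node by \<open>m + 1\<close> gives an odd multiple of
  \<open>pi / 2\<close>.\<close>

lemma chebyshev_poly_root:
  assumes "x \<in> chebyshev_points m"
  shows "poly (chebyshev_poly (Suc m)) x = 0"
proof -
  from assms obtain i where x: "x = cos ((2 * real i + 1) * pi / (2 * real m + 2))"
    by (auto simp: chebyshev_points_def)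
  have "real (Suc m) * ((2 * real i + 1) * pi / (2 * real m + 2)) = of_int (2 * int i + 1) * (pi / 2)"
    by (simp add: field_simps)
  then show ?thesis
    unfolding x poly_chebyshev_poly_cos cos_zero_iff_int
    by (metis odd_two_times_div_two_succ even_mult_iff dvd_triv_left even_plus_one_iff)
qed

text \<open>The leading coefficients cancel in the difference of the two sides; if nonzero, it would
  have degree at most \<open>m\<close> but \<open>m + 1\<close> distinct roots.\<close>

lemma chebyshev_poly_factorization:
  "chebyshev_poly (Suc m) = smult (2 ^ m) (\<Prod>u\<in>chebyshev_points m. [:- u, 1:])" (is "?T = smult _ ?W")
proof -
  let ?R = "?T - smult (2 ^ m) ?W"
  have W: "degree ?W = Suc m" "coeff ?W (Suc m) = 1"
    using monic_prod_linear[of "chebyshev_points m"] by (simp_all add: card_chebyshev_points)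
  have "degree ?R \<le> Suc m"
    using W degree_chebyshev_poly[of "Suc m"] by (intro degree_diff_le) auto
  moreover have "coeff ?R (Suc m) = 0"
    using W by (simp add: coeff_chebyshev_poly del: chebyshev_poly.simps)
  \<comment> \<open>If the degree were \<open>Suc m\<close>, the vanishing coefficient would be the
    leading one, forcing \<open>?R = 0\<close>.\<close>
  ultimately have deg: "degree ?R < Suc m \<or> ?R = 0"
    by (metis le_neq_implies_less leading_coeff_0_iff)
  have "?R = 0"
  proof (rule ccontr)
    assume R: "?R \<noteq> 0"
    have "poly ?R x = 0" if "x \<in> chebyshev_points m" for x
    proof -
      have "poly ?W x = 0" using that by (auto simp: poly_prod intro!: prod_zero)
      with chebyshev_poly_root[OF that] show ?thesis by simp
    qed
    then have "card (chebyshev_points m) \<le> card {x. poly ?R x = 0}"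
      using poly_roots_finite[OF R] by (intro card_mono) auto
    also have "\<dots> \<le> degree ?R" by (rule card_poly_roots_bound[OF R])
    finally show False using deg R by (simp add: card_chebyshev_points)
  qed
  then show ?thesis by simp
qed

text \<open>By the factorization, \<open>2 ^ m\<close> times the product is a value of the Chebyshev
  polynomial, which is a cosine after writing \<open>x = cos (arccos x)\<close>.\<close>

lemma abs_prod_chebyshev_points_le:
  assumes "x \<in> {-1..1}"
  shows "\<bar>\<Prod>u\<in>chebyshev_points m. x - u\<bar> \<le> 1 / 2 ^ m"
proof -
  have "poly (chebyshev_poly (Suc m)) x = cos (real (Suc m) * arccos x)"
    using poly_chebyshev_poly_cos[of "Suc m" "arccos x"] assms by simp
  then have "2 ^ m * (\<Prod>u\<in>chebyshev_points m. x - u) = cos (real (Suc m) * arccos x)"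
    by (simp add: chebyshev_poly_factorization poly_prod)
  then have "2 ^ m * \<bar>\<Prod>u\<in>chebyshev_points m. x - u\<bar> \<le> 1"
    by (metis abs_cos_le_one abs_mult abs_of_pos zero_less_numeral zero_less_power)
  then show ?thesis by (simp add: field_simps)
qed

text \<open>The abstract family \<open>D\<close> allows the derivatives of the local function to be
  supplied explicitly, with their chain rule factors.\<close>

lemma chebyshev_interpolation_error:
  fixes D :: "nat \<Rightarrow> real \<Rightarrow> real"
  assumes "\<And>i x. i \<le> m \<Longrightarrow> x \<in> {-1..1} \<Longrightarrow> (D i has_real_derivative D (Suc i) x) (at x within {-1..1})"
    and bound: "\<And>x. x \<in> {-1..1} \<Longrightarrow> \<bar>D (m + 1) x\<bar> \<le> M"
    and x: "x \<in> {-1..1}"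
  shows "\<bar>D 0 x - poly (lagrange_poly (chebyshev_points m) (D 0)) x\<bar> \<le> M / (2 ^ m * fact (m + 1))"
proof -
  have "chebyshev_points m \<noteq> {}" using card_chebyshev_points[of m] by auto
  moreover have "(D i has_real_derivative D (Suc i) y) (at y within {-1..1})"
    if "i < card (chebyshev_points m)" "y \<in> {-1..1}" for i y
    using assms(1)[of i y] that by (simp add: card_chebyshev_points)
  ultimately obtain \<xi> where \<xi>: "\<xi> \<in> {-1..1}"
    "D 0 x - poly (lagrange_poly (chebyshev_points m) (D 0)) x
       = D (m + 1) \<xi> / fact (m + 1) * (\<Prod>u\<in>chebyshev_points m. x - u)"
    using lagrange_remainder[of "chebyshev_points m" "-1" 1 D x] x chebyshev_points_subset
    unfolding card_chebyshev_points by (metis finite_chebyshev_points)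
  have "\<bar>D 0 x - poly (lagrange_poly (chebyshev_points m) (D 0)) x\<bar>
      = \<bar>D (m + 1) \<xi>\<bar> / fact (m + 1) * \<bar>\<Prod>u\<in>chebyshev_points m. x - u\<bar>"
    unfolding \<xi>(2) by (simp add: abs_mult)
  also have "\<dots> \<le> M / fact (m + 1) * (1 / 2 ^ m)"
    using bound[OF \<xi>(1)] abs_prod_chebyshev_points_le[OF x]
    by (intro mult_mono divide_right_mono) auto
  finally show ?thesis by (simp add: mult.commute)
qed

section \<open>Iterated derivatives and the sup norm on a set\<close>

text \<open>Differentiability turns the value selected by \<open>vector_derivative\<close> into a
  genuine derivative, as the remainder formula demands.\<close>

lemma C_k_on_has_derivative:
  assumes "C_k_on k S f" "j < k" "x \<in> S" "at x within S \<noteq> bot"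
  shows "(nth_deriv_on S j f has_real_derivative nth_deriv_on S (Suc j) f x) (at x within S)"
proof -
  have "nth_deriv_on S j f differentiable (at x within S)"
    using assms by (auto simp: C_k_on_def differentiable_on_def)
  then show ?thesis
    by (simp add: nth_deriv_on_def vector_derivative_works has_real_derivative_iff_has_vector_derivative)
qed

lemma abs_le_sup_norm_on:
  assumes "compact S" "continuous_on S g" "x \<in> S"
  shows "\<bar>g x\<bar> \<le> sup_norm_on S g"
proof -
  have "compact ((\<lambda>x. \<bar>g x\<bar>) ` S)"
    using assms by (intro compact_continuous_image continuous_intros)
  then have "bdd_above ((\<lambda>x. \<bar>g x\<bar>) ` S)" by (simp add: bounded_imp_bdd_above compact_imp_bounded)
  then show ?thesis unfolding sup_norm_on_def using assms by (intro cSUP_upper)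
qed

section \<open>The graded mesh\<close>

lemma mesh_width_pos:
  assumes "\<alpha> > 1" "n > 1" "j \<ge> 1"
  shows "mesh_width \<alpha> n j > 0"
\<comment> \<open>The mesh point 0 lies outside the geometric progression formed by the others, so
  the first interval is treated separately.\<close>
proof (cases "j = 1")
  case False
  then have "(real (j - 1) - 1) / (real n - 1) < (real j - 1) / (real n - 1)"
    using assms by (intro divide_strict_right_mono) (auto simp: of_nat_diff)
  then show ?thesis using False assms by (simp add: mesh_width_def mesh_point_def)
qed (use assms in \<open>simp add: mesh_width_def mesh_point_def\<close>)

lemma mesh_point_last:
  assumes "\<alpha> > 1" "n > 1"
  shows "mesh_point \<alpha> n n = 1"
  using assms by (simp add: mesh_point_def)

lemma mesh_point_in_unit:
  assumes "\<alpha> > 1" "n > 1" "j \<le> n"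
  shows "mesh_point \<alpha> n j \<in> {0..1}"
proof (cases "j = 0")
  case False
  have "\<alpha> powr ((real j - 1) / (real n - 1) - 1) \<le> \<alpha> powr 0"
    using assms by (intro powr_mono) (auto simp: field_simps)
  then show ?thesis using assms False by (simp add: mesh_point_def)
qed (simp add: mesh_point_def)

text \<open>The first width is \<open>1 / \<alpha>\<close>. From the second interval on, consecutive
  points have the fixed ratio \<open>\<alpha> powr (- 1 / (real n - 1))\<close>, so a width is its
  right endpoint, at most 1, times one minus that ratio.\<close>

lemma mesh_width_le:
  assumes "\<alpha> > 1" "n > 1" "1 \<le> j" "j \<le> n"
  shows "mesh_width \<alpha> n j \<le> max (1 / \<alpha>) (1 - \<alpha> powr (- 1 / (real n - 1)))"
proof (cases "j = 1")
  case True
  then show ?thesis using assms by (simp add: mesh_width_def mesh_point_def powr_minus_divide)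
next
  case False
  have n: "real n - 1 > 0" using assms by simp
  have "(real j - 1 - 1) / (real n - 1) - 1 = (real j - 1) / (real n - 1) - 1 + - 1 / (real n - 1)"
    by (simp add: diff_divide_distrib)
  then have "\<alpha> powr ((real j - 1 - 1) / (real n - 1) - 1)
      = \<alpha> powr ((real j - 1) / (real n - 1) - 1) * \<alpha> powr (- 1 / (real n - 1))"
    by (simp only: powr_add)
  then have "mesh_point \<alpha> n (j - 1) = mesh_point \<alpha> n j * \<alpha> powr (- 1 / (real n - 1))"
    using assms(3) False by (simp add: mesh_point_def of_nat_diff)
  then have "mesh_width \<alpha> n j = mesh_point \<alpha> n j * (1 - \<alpha> powr (- 1 / (real n - 1)))"
    by (simp add: mesh_width_def right_diff_distrib)
  also have "\<dots> \<le> 1 * (1 - \<alpha> powr (- 1 / (real n - 1)))"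
  proof (rule mult_right_mono)
    show "mesh_point \<alpha> n j \<le> 1" using mesh_point_in_unit[of \<alpha> n j] assms by simp
    have "\<alpha> powr (- 1 / (real n - 1)) \<le> \<alpha> powr 0" using assms n by (intro powr_mono) auto
    then show "0 \<le> 1 - \<alpha> powr (- 1 / (real n - 1))" using assms by simp
  qed
  finally show ?thesis by simp
qed

section \<open>Transfer to the reference interval\<close>

lemma local_map_image:
  assumes "mesh_width \<alpha> n j > 0"
  shows "local_map \<alpha> n j ` {-1..1} = {mesh_point \<alpha> n (j - 1)..mesh_point \<alpha> n j}"
proof -
  have "local_map \<alpha> n j ` {-1..1} = (\<lambda>x. mesh_width \<alpha> n j / 2 * x
      + (mesh_point \<alpha> n (j - 1) + mesh_point \<alpha> n j) / 2) ` {-1..1}"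
    by (simp add: local_map_def)
  also have "\<dots> = {mesh_point \<alpha> n (j - 1)..mesh_point \<alpha> n j}"
    using assms by (subst image_affinity_atLeastAtMost) (simp add: mesh_width_def field_simps)
  finally show ?thesis .
qed

text \<open>The local parameters are made so that both exponents are minus the square of the same
  number.\<close>

lemma gauss_local:
  assumes "mesh_width \<alpha> n j > 0"
  shows "gauss (local_alpha \<alpha> n j) (local_beta \<alpha> n j) x = gauss \<alpha> 0 (local_map \<alpha> n j x)"
proof -
  have "local_alpha \<alpha> n j * (x - local_beta \<alpha> n j) = \<alpha> * local_map \<alpha> n j x"
    using assms by (simp add: local_alpha_def local_beta_def local_map_def field_simps)
  then show ?thesis
    by (simp add: gauss_def flip: power_mult_distrib)
qed

text \<open>The factor \<open>mesh_width \<alpha> n j / 2\<close> is the Jacobian;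
  \<open>local_fun\<close> carries the same factor.\<close>

lemma integral_local_map:
  fixes F :: "real \<Rightarrow> real"
  assumes h: "mesh_width \<alpha> n j > 0"
    and F: "continuous_on {mesh_point \<alpha> n (j - 1)..mesh_point \<alpha> n j} F"
  shows "integral {-1..1} (\<lambda>x. mesh_width \<alpha> n j / 2 * F (local_map \<alpha> n j x))
           = integral {mesh_point \<alpha> n (j - 1)..mesh_point \<alpha> n j} F"
proof -
  \<comment> \<open>The substitution rule covers both orientations; here the subtracted integral
    runs over an empty interval.\<close>
  have "((\<lambda>x. (mesh_width \<alpha> n j / 2) *\<^sub>R F (local_map \<alpha> n j x)) has_integral
      integral {local_map \<alpha> n j (-1)..local_map \<alpha> n j 1} F
      - integral {local_map \<alpha> n j 1..local_map \<alpha> n j (-1)} F) {-1..1}"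
  proof (rule has_integral_substitution_general[where s = "{}"])
    show "local_map \<alpha> n j ` {-1..1} \<subseteq> {mesh_point \<alpha> n (j - 1)..mesh_point \<alpha> n j}"
      using local_map_image[OF h] by simp
    show "continuous_on {-1..1} (local_map \<alpha> n j)"
      unfolding local_map_def by (intro continuous_intros)
    show "(local_map \<alpha> n j has_real_derivative mesh_width \<alpha> n j / 2) (at x within {-1..1})" for x
      unfolding local_map_def by (auto intro!: derivative_eq_intros)
  qed (use F in auto)
  moreover have "local_map \<alpha> n j (-1) = mesh_point \<alpha> n (j - 1)" "local_map \<alpha> n j 1 = mesh_point \<alpha> n j"
    by (simp_all add: local_map_def mesh_width_def field_simps)
  moreover have "mesh_point \<alpha> n (j - 1) < mesh_point \<alpha> n j" using h by (simp add: mesh_width_def)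
  ultimately show ?thesis by (auto dest!: integral_unique)
qed

text \<open>Induction on the initial segments \<open>[0, mesh_point \<alpha> n k]\<close>, the last
  of which is \<open>[0, 1]\<close>.\<close>

lemma integral_mesh_sum:
  fixes F :: "real \<Rightarrow> real"
  assumes "\<alpha> > 1" "n > 1" "continuous_on {0..1} F"
  shows "integral {0..1} F = (\<Sum>j = 1..n. integral {mesh_point \<alpha> n (j - 1)..mesh_point \<alpha> n j} F)"
proof -
  have "integral {0..mesh_point \<alpha> n k} F
      = (\<Sum>j = 1..k. integral {mesh_point \<alpha> n (j - 1)..mesh_point \<alpha> n j} F)" if "k \<le> n" for k
    using that
  proof (induction k)
    case 0
    then show ?case by (simp add: mesh_point_def)
  next
    case (Suc k)
    have "integral {0..mesh_point \<alpha> n k} F + integral {mesh_point \<alpha> n k..mesh_point \<alpha> n (Suc k)} F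
        = integral {0..mesh_point \<alpha> n (Suc k)} F"
    proof (rule Henstock_Kurzweil_Integration.integral_combine)
      show "0 \<le> mesh_point \<alpha> n k" using mesh_point_in_unit[of \<alpha> n k] assms Suc by simp
      show "mesh_point \<alpha> n k \<le> mesh_point \<alpha> n (Suc k)"
        using mesh_width_pos[of \<alpha> n "Suc k"] assms by (simp add: mesh_width_def)
      show "F integrable_on {0..mesh_point \<alpha> n (Suc k)}"
        using mesh_point_in_unit[of \<alpha> n "Suc k"] assms Suc
        by (intro integrable_continuous_real continuous_on_subset[OF assms(3)]) auto
    qed
    then show ?case using Suc by simp
  qed
  from this[of n] show ?thesis using assms by (simp add: mesh_point_last)
qed

section \<open>The Gaussian weight\<close>

lemma continuous_on_gauss: "continuous_on S (gauss \<alpha> \<beta>)"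
  unfolding gauss_def by (intro continuous_intros)

lemma gauss_pos: "gauss \<alpha> \<beta> x > 0"
  by (simp add: gauss_def)

lemma integral_gauss_le:
  assumes "\<alpha> > 0"
  shows "integral {0..1} (gauss \<alpha> 0) \<le> sqrt pi / \<alpha>"
proof -
  \<comment> \<open>The antiderivative is \<open>arctan (\<alpha> * x) / \<alpha>\<close>.\<close>
  have I: "((\<lambda>x. 1 / (1 + (\<alpha> * x)\<^sup>2)) has_integral arctan (\<alpha> * 1) / \<alpha> - arctan (\<alpha> * 0) / \<alpha>) {0..1}"
    using assms
    by (intro fundamental_theorem_of_calculus)
       (auto intro!: derivative_eq_intros simp: divide_inverse
             simp flip: has_real_derivative_iff_has_vector_derivative)
  have "integral {0..1} (gauss \<alpha> 0) \<le> integral {0..1} (\<lambda>x. 1 / (1 + (\<alpha> * x)\<^sup>2))"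
  proof (rule integral_le)
    show "gauss \<alpha> 0 integrable_on {0..1}"
      by (intro integrable_continuous_real continuous_on_gauss)
    show "(\<lambda>x. 1 / (1 + (\<alpha> * x)\<^sup>2)) integrable_on {0..1}" using I by blast
    fix x :: real
    have "1 + (\<alpha> * x)\<^sup>2 \<le> exp ((\<alpha> * x)\<^sup>2)" by (rule exp_ge_add_one_self)
    then have "1 / exp ((\<alpha> * x)\<^sup>2) \<le> 1 / (1 + (\<alpha> * x)\<^sup>2)"
      by (intro divide_left_mono) (auto intro!: mult_pos_pos add_pos_nonneg)
    then show "gauss \<alpha> 0 x \<le> 1 / (1 + (\<alpha> * x)\<^sup>2)"
      by (simp add: gauss_def exp_minus inverse_eq_divide power_mult_distrib)
  qed
  also have "\<dots> = arctan \<alpha> / \<alpha>" using I by (simp add: integral_unique)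
  also have "\<dots> \<le> sqrt pi / \<alpha>"
  proof (rule divide_right_mono)
    \<comment> \<open>After squaring, this amounts to \<open>pi \<le> 4\<close>.\<close>
    have "pi / 2 \<le> sqrt pi"
    proof (rule real_le_rsqrt)
      have "pi * pi \<le> pi * 4" using pi_less_4 by (intro mult_left_mono) auto
      then show "(pi / 2)\<^sup>2 \<le> pi" by (simp add: power2_eq_square)
    qed
    then show "arctan \<alpha> \<le> sqrt pi" using arctan_ubound[of \<alpha>] by linarith
  qed (use assms in simp)
  finally show ?thesis .
qed

section \<open>The error on one subinterval\<close>

text \<open>The power \<open>2 ^ (2 * m + 1)\<close> combines \<open>2 ^ m\<close> from the
  Chebyshev nodes with \<open>2 ^ (m + 1)\<close> from the scaling by half the width. The remaining
  factor of half the width is kept apart, to serve as Jacobian under the integral.\<close>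

lemma local_interpolation_error:
  assumes \<alpha>: "\<alpha> > 1" and n: "n > 1" and j: "1 \<le> j" "j \<le> n"
    and f: "C_k_on (m + 1) {0..1} f" and x: "x \<in> {-1..1}"
  shows "\<bar>local_fun \<alpha> n f j x - poly (lagrange_poly (chebyshev_points m) (local_fun \<alpha> n f j)) x\<bar>
    \<le> mesh_width \<alpha> n j / 2 * (mesh_width \<alpha> n j ^ (m + 1) / (2 ^ (2 * m + 1) * fact (m + 1))
        * sup_norm_on {0..1} (nth_deriv_on {0..1} (m + 1) f))"
proof -
  define h where "h = mesh_width \<alpha> n j"
  define M where "M = sup_norm_on {0..1} (nth_deriv_on {0..1} (m + 1) f)"
  \<comment> \<open>The derivative of order \<open>i\<close> has \<open>i\<close> factors
    \<open>h / 2\<close> from the chain rule and one from the definition of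
    \<open>local_fun\<close>.\<close>
  define D where "D = (\<lambda>i x. (h / 2) ^ (i + 1) * nth_deriv_on {0..1} i f (local_map \<alpha> n j x))"
  have h: "h > 0" unfolding h_def using mesh_width_pos \<alpha> n j by simp
  have sub: "local_map \<alpha> n j ` {-1..1} \<subseteq> {0..1}"
    using local_map_image[of \<alpha> n j] h mesh_point_in_unit[of \<alpha> n "j - 1"] mesh_point_in_unit[of \<alpha> n j] \<alpha> n j
    by (auto simp: h_def)
  have D0: "D 0 = local_fun \<alpha> n f j"
    by (auto simp: D_def local_fun_def nth_deriv_on_def h_def)
  have "\<bar>D 0 x - poly (lagrange_poly (chebyshev_points m) (D 0)) x\<bar>
      \<le> (h / 2) ^ (m + 2) * M / (2 ^ m * fact (m + 1))"
  proof (rule chebyshev_interpolation_error[OF _ _ x])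
    fix i y assume i: "i \<le> m" and y: "y \<in> {-1..1::real}"
    \<comment> \<open>Restricting the derivative to the image of the reference interval gives the
      form that \<open>DERIV_image_chain\<close> takes, endpoints included.\<close>
    have "(nth_deriv_on {0..1} i f has_real_derivative nth_deriv_on {0..1} (Suc i) f (local_map \<alpha> n j y))
        (at (local_map \<alpha> n j y) within local_map \<alpha> n j ` {-1..1})"
    proof (rule DERIV_subset[OF C_k_on_has_derivative[OF f _ _] sub])
      show "local_map \<alpha> n j y \<in> {0..1}" using y sub by blast
      then show "at (local_map \<alpha> n j y) within {0..1} \<noteq> bot"
        by (simp add: trivial_limit_within islimpt_Icc)
    qed (use i in simp)
    moreover have "(local_map \<alpha> n j has_real_derivative h / 2) (at y within {-1..1})"
      unfolding local_map_def h_def by (auto intro!: derivative_eq_intros)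
    ultimately have "((nth_deriv_on {0..1} i f \<circ> local_map \<alpha> n j) has_real_derivative
        nth_deriv_on {0..1} (Suc i) f (local_map \<alpha> n j y) * (h / 2)) (at y within {-1..1})"
      by (rule DERIV_image_chain)
    from DERIV_cmult[OF this, of "(h / 2) ^ (i + 1)"]
    show "(D i has_real_derivative D (Suc i) y) (at y within {-1..1})"
      by (simp add: D_def o_def mult_ac)
  next
    fix y assume y: "y \<in> {-1..1::real}"
    have "\<bar>nth_deriv_on {0..1} (m + 1) f (local_map \<alpha> n j y)\<bar> \<le> M"
    proof (unfold M_def, rule abs_le_sup_norm_on)
      show "local_map \<alpha> n j y \<in> {0..1}" using y sub by blast
    qed (use f in \<open>auto simp: C_k_on_def\<close>)
    then have "(h / 2) ^ (m + 2) * \<bar>nth_deriv_on {0..1} (m + 1) f (local_map \<alpha> n j y)\<bar>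
        \<le> (h / 2) ^ (m + 2) * M"
      using h by (intro mult_left_mono) auto
    then show "\<bar>D (m + 1) y\<bar> \<le> (h / 2) ^ (m + 2) * M"
      using h by (simp add: D_def abs_mult)
  qed
  also have "\<dots> = h / 2 * (h ^ (m + 1) / (2 ^ (2 * m + 1) * fact (m + 1)) * M)"
    by (simp add: power_divide power_add power_mult field_simps power2_eq_square flip: power_mult_distrib)
  finally show ?thesis unfolding D0 h_def M_def .
qed

text \<open>On the reference interval the pointwise interpolation error is integrated against the
  positive weight. Keeping the weight integral over \<open>J\<close> in the bound lets the
  contributions be added up over the mesh.\<close>

lemma basic_quadrature_error:
  assumes \<alpha>: "\<alpha> > 1" and n: "n > 1" and j: "1 \<le> j" "j \<le> n"
    and f: "C_k_on (m + 1) {0..1} f"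
  defines "J \<equiv> {mesh_point \<alpha> n (j - 1)..mesh_point \<alpha> n j}"
  shows "\<bar>integral J (\<lambda>x. f x * gauss \<alpha> 0 x)
           - basic_quadrature (local_alpha \<alpha> n j) (local_beta \<alpha> n j) m (local_fun \<alpha> n f j)\<bar>
    \<le> mesh_width \<alpha> n j ^ (m + 1) / (2 ^ (2 * m + 1) * fact (m + 1))
        * sup_norm_on {0..1} (nth_deriv_on {0..1} (m + 1) f) * integral J (gauss \<alpha> 0)"
proof -
  define h where "h = mesh_width \<alpha> n j"
  define E where "E = h ^ (m + 1) / (2 ^ (2 * m + 1) * fact (m + 1))
        * sup_norm_on {0..1} (nth_deriv_on {0..1} (m + 1) f)"
  let ?\<phi> = "local_map \<alpha> n j" and ?g = "local_fun \<alpha> n f j"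
  let ?p = "poly (lagrange_poly (chebyshev_points m) ?g)"
  let ?G = "\<lambda>x. gauss \<alpha> 0 (?\<phi> x)"
  have h: "mesh_width \<alpha> n j > 0" using mesh_width_pos \<alpha> n j by simp
  have J: "?\<phi> ` {-1..1} = J" unfolding J_def by (rule local_map_image[OF h])
  have "J \<subseteq> {0..1}"
    using mesh_point_in_unit[of \<alpha> n "j - 1"] mesh_point_in_unit[of \<alpha> n j] \<alpha> n j by (auto simp: J_def)
  \<comment> \<open>The order-zero clause of \<open>C_k_on\<close>, available because
    \<open>m + 1\<close> is positive.\<close>
  moreover have "f differentiable_on {0..1}"
    using f unfolding C_k_on_def nth_deriv_on_def by force
  ultimately have fc: "continuous_on J f"
    using differentiable_imp_continuous_on continuous_on_subset by blast
  have \<phi>c: "continuous_on {-1..1} ?\<phi>" unfolding local_map_def by (intro continuous_intros)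
  have Gc: "continuous_on {-1..1} ?G"
    by (rule continuous_on_compose2[OF continuous_on_gauss \<phi>c subset_UNIV])
  have gc: "continuous_on {-1..1} ?g"
    unfolding local_fun_def
    by (intro continuous_intros continuous_on_compose2[OF fc \<phi>c]) (use J in auto)
  have intG: "integral J F = integral {-1..1} (\<lambda>x. h / 2 * F (?\<phi> x))" if "continuous_on J F" for F
    using integral_local_map[OF h] that unfolding J_def h_def by simp
  have "integral J (\<lambda>x. f x * gauss \<alpha> 0 x) = integral {-1..1} (\<lambda>x. ?g x * ?G x)"
    by (subst intG) (auto intro!: continuous_intros fc continuous_on_gauss simp: local_fun_def h_def mult_ac)
  moreover have "basic_quadrature (local_alpha \<alpha> n j) (local_beta \<alpha> n j) m ?g
      = integral {-1..1} (\<lambda>x. ?p x * ?G x)"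
    by (simp add: basic_quadrature_def gauss_integral_def gauss_local[OF h])
  moreover have "integral {-1..1} (\<lambda>x. ?g x * ?G x) - integral {-1..1} (\<lambda>x. ?p x * ?G x)
      = integral {-1..1} (\<lambda>x. ?g x * ?G x - ?p x * ?G x)"
    by (intro integral_diff[symmetric] integrable_continuous_real continuous_intros gc Gc)
  moreover have "norm (integral {-1..1} (\<lambda>x. ?g x * ?G x - ?p x * ?G x))
      \<le> integral {-1..1} (\<lambda>x. E * (h / 2 * ?G x))"
  proof (rule integral_norm_bound_integral)
    fix x :: real assume x: "x \<in> {-1..1}"
    have "norm (?g x * ?G x - ?p x * ?G x) = \<bar>?g x - ?p x\<bar> * ?G x"
      using gauss_pos[of \<alpha> 0 "?\<phi> x"] by (simp add: abs_mult flip: left_diff_distrib)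
    also have "\<dots> \<le> h / 2 * E * ?G x"
      using local_interpolation_error[OF \<alpha> n j f x] gauss_pos[of \<alpha> 0 "?\<phi> x"]
      unfolding E_def h_def by (intro mult_right_mono) auto
    finally show "norm (?g x * ?G x - ?p x * ?G x) \<le> E * (h / 2 * ?G x)" by (simp add: mult_ac)
  qed (intro integrable_continuous_real continuous_intros gc Gc)+
  \<comment> \<open>The factor \<open>h / 2\<close> from the error bound acts as the Jacobian and
    carries the weight back to \<open>J\<close>.\<close>
  moreover have "integral {-1..1} (\<lambda>x. E * (h / 2 * ?G x)) = E * integral J (gauss \<alpha> 0)"
    by (simp add: intG continuous_on_gauss)
  ultimately show ?thesis by (simp add: E_def h_def)
qed

section \<open>Node count and summation over the mesh\<close>

text \<open>Each \<open>local_map\<close> has positive slope, so no two Chebyshev points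
  collapse.\<close>

lemma num_nodes_eq:
  assumes "\<alpha> > 1" "n > 1"
  shows "num_nodes \<alpha> n m = (m + 1) * n"
proof -
  have "card (quadrature_nodes \<alpha> n m j) = m + 1" if "j \<in> {1..n}" for j
  proof -
    have "inj_on (local_map \<alpha> n j) (chebyshev_points m)"
      using mesh_width_pos[of \<alpha> n j] assms that by (auto simp: inj_on_def local_map_def)
    then show ?thesis by (simp add: quadrature_nodes_def card_image card_chebyshev_points)
  qed
  then show ?thesis by (simp add: num_nodes_def)
qed

theorem theorem4p2:
  fixes \<alpha> \<eta> :: real and n m :: nat and f :: "real \<Rightarrow> real"
  assumes "\<alpha> > 1" and "n > 1" and "m \<ge> 1"
    and "\<eta> = max (1 / \<alpha>) (1 - \<alpha> powr (- 1 / (real n - 1)))"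
    and "C_k_on (m + 1) {0..1} f"
  shows "quadrature_error \<alpha> n m f
           \<le> sqrt pi * \<eta> ^ m / (2 ^ (2 * m + 1) * fact (m + 1) * \<alpha>)
             * sup_norm_on {0..1} (nth_deriv_on {0..1} (m + 1) f)
         \<and> num_nodes \<alpha> n m = (m + 1) * n"
proof
  define M where "M = sup_norm_on {0..1} (nth_deriv_on {0..1} (m + 1) f)"
  define C where "C = \<eta> ^ m / (2 ^ (2 * m + 1) * fact (m + 1)) * M"
  let ?J = "\<lambda>j. {mesh_point \<alpha> n (j - 1)..mesh_point \<alpha> n j}"
  let ?Q = "\<lambda>j. basic_quadrature (local_alpha \<alpha> n j) (local_beta \<alpha> n j) m (local_fun \<alpha> n f j)"
  note f = assms(5)
  \<comment> \<open>Evaluation at a single point shows that the supremum is nonnegative.\<close>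
  have "\<bar>nth_deriv_on {0..1} (m + 1) f 0\<bar> \<le> M"
    unfolding M_def using f by (intro abs_le_sup_norm_on) (auto simp: C_k_on_def)
  then have M: "M \<ge> 0" by linarith
  have \<eta>: "0 \<le> \<eta>" "\<eta> \<le> 1" using assms(1) by (auto simp: assms(4) le_max_iff_disj)
  have C: "C \<ge> 0" using M \<eta> by (simp add: C_def)
  have fc: "continuous_on {0..1} f"
    using f unfolding C_k_on_def nth_deriv_on_def by (force intro: differentiable_imp_continuous_on)
  have "gauss_integral01 \<alpha> f - composite_quadrature \<alpha> n m f
      = (\<Sum>j = 1..n. integral (?J j) (\<lambda>x. f x * gauss \<alpha> 0 x) - ?Q j)"
    unfolding gauss_integral01_def composite_quadrature_def sum_subtractf
    by (subst integral_mesh_sum[OF assms(1,2)]) (auto intro!: continuous_intros fc continuous_on_gauss)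
  then have "quadrature_error \<alpha> n m f \<le> (\<Sum>j = 1..n. \<bar>integral (?J j) (\<lambda>x. f x * gauss \<alpha> 0 x) - ?Q j\<bar>)"
    unfolding quadrature_error_def by simp
  also have "\<dots> \<le> (\<Sum>j = 1..n. C * integral (?J j) (gauss \<alpha> 0))"
  proof (rule sum_mono)
    fix j assume "j \<in> {1..n}"
    then have j: "1 \<le> j" "j \<le> n" by auto
    have "mesh_width \<alpha> n j ^ (m + 1) \<le> \<eta> ^ (m + 1)"
      using mesh_width_le[OF assms(1,2) j] mesh_width_pos[of \<alpha> n j] assms(1,2) j
      unfolding assms(4) by (intro power_mono) auto
    \<comment> \<open>One of the \<open>m + 1\<close> factors is given up, as
      \<open>0 \<le> \<eta> \<le> 1\<close> permits, to reach the exponent of the claim.\<close>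
    also have "\<dots> \<le> \<eta> ^ m" using \<eta> by (intro power_decreasing) auto
    finally have "mesh_width \<alpha> n j ^ (m + 1) / (2 ^ (2 * m + 1) * fact (m + 1)) * M \<le> C"
      unfolding C_def using M by (intro mult_right_mono divide_right_mono) auto
    moreover have "integral (?J j) (gauss \<alpha> 0) \<ge> 0"
      by (intro integral_nonneg integrable_continuous_real continuous_on_gauss) (simp add: gauss_pos less_imp_le)
    ultimately show "\<bar>integral (?J j) (\<lambda>x. f x * gauss \<alpha> 0 x) - ?Q j\<bar> \<le> C * integral (?J j) (gauss \<alpha> 0)"
      using basic_quadrature_error[OF assms(1,2) j f]
      unfolding M_def by (meson mult_right_mono order_trans)
  qed
  \<comment> \<open>The weight integrals recombine by the same decomposition that split the integral
    of \<open>f\<close>.\<close>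
  also have "\<dots> = C * integral {0..1} (gauss \<alpha> 0)"
    unfolding integral_mesh_sum[OF assms(1,2) continuous_on_gauss] by (simp add: sum_distrib_left)
  also have "\<dots> \<le> C * (sqrt pi / \<alpha>)"
    using C assms(1) by (intro mult_left_mono integral_gauss_le) auto
  finally show "quadrature_error \<alpha> n m f
      \<le> sqrt pi * \<eta> ^ m / (2 ^ (2 * m + 1) * fact (m + 1) * \<alpha>)
        * sup_norm_on {0..1} (nth_deriv_on {0..1} (m + 1) f)"
    by (simp add: C_def M_def mult_ac)
qed (rule num_nodes_eq[OF assms(1,2)])

end
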